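(* Let $\mathfrak{A}$ be a normal residuated lattice. Then for any filter $F$ of $\mathfrak{A}$ there exists a largest $\omega$-filter contained in $F$.
   Context: A residuated lattice is an algebra $\mathfrak{A}=(A;\vee,\wedge,\odot,\rightarrow,0,1)$ such that $\ell(\mathfrak{A})=(A;\vee,\wedge,0,1)$ is a bounded lattice, $(A;\odot,1)$ is a commutative monoid, and $x\odot y\leq z$ iff $x\leq y\rightarrow z$ for all $x,y,z\in A$. A filter of $\mathfrak{A}$ is a non-empty subset $F\subseteq A$ such that $x,y\in F$ implies $x\odot y\in F$, and $x\in F$, $y\in A$ implies $x\vee y\in F$. A filter $P\neq A$ is prime if $x\vee y\in P$ implies $x\in P$ or $y\in P$; a minimal prime filter is a minimal element (under inclusion) of the set of all prime filters. $\mathfrak{A}$ is normal if every prime filter contains at most one minimal prime filter. An ideal of $\ell(\mathfrak{A})$ is a non-empty subset of $A$ closed under $\vee$ and downward closed. For $X\subseteq A$, $\omega(X)=\{a\in A\mid x\vee a=1\text{ for some }x\in X\}$. A filter $H$ is an $\omega$-filter if $H=\omega(I)$ for some ideal $I$ of $\ell(\mathfrak{A})$. "Largest" refers to inclusion. *)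

theory Defs
  imports Main
begin

text \<open>
  The carrier is the whole type; the constants 0 and 1 of the algebra are \<open>bot\<close> and \<open>top\<close>.
  The degenerate case \<open>bot = top\<close> is allowed.
\<close>

class residuated_lattice = bounded_lattice +
  fixes odot :: "'a \<Rightarrow> 'a \<Rightarrow> 'a" (infixl \<open>\<odot>\<close> 70)
    and residuum :: "'a \<Rightarrow> 'a \<Rightarrow> 'a" (infixr \<open>\<rightharpoonup>\<close> 60)
  assumes odot_comm_monoid: "comm_monoid odot top"
    and residuation: "x \<odot> y \<le> z \<longleftrightarrow> x \<le> y \<rightharpoonup> z"
begin

definition rl_filter :: "'a set \<Rightarrow> bool" where
  "rl_filter F \<longleftrightarrow> F \<noteq> {} \<and> (\<forall>x\<in>F. \<forall>y\<in>F. x \<odot> y \<in> F) \<and> (\<forall>x\<in>F. \<forall>y. sup x y \<in> F)"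

definition prime_filter :: "'a set \<Rightarrow> bool" where
  "prime_filter P \<longleftrightarrow>
     rl_filter P \<and> P \<noteq> UNIV \<and> (\<forall>x y. sup x y \<in> P \<longrightarrow> x \<in> P \<or> y \<in> P)"

definition minimal_prime_filter :: "'a set \<Rightarrow> bool" where
  "minimal_prime_filter M \<longleftrightarrow>
     prime_filter M \<and> (\<forall>P. prime_filter P \<and> P \<subseteq> M \<longrightarrow> P = M)"

definition lattice_ideal :: "'a set \<Rightarrow> bool" where
  "lattice_ideal I \<longleftrightarrow>
     I \<noteq> {} \<and> (\<forall>x\<in>I. \<forall>y\<in>I. sup x y \<in> I) \<and> (\<forall>x\<in>I. \<forall>y. y \<le> x \<longrightarrow> y \<in> I)"

definition omega :: "'a set \<Rightarrow> 'a set" where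
  "omega X = {a. \<exists>x\<in>X. sup x a = top}"

definition omega_filter :: "'a set \<Rightarrow> bool" where
  "omega_filter H \<longleftrightarrow> rl_filter H \<and> (\<exists>I. lattice_ideal I \<and> H = omega I)"

end

class normal_residuated_lattice = residuated_lattice +
  assumes normal:
    "\<lbrakk>prime_filter P; minimal_prime_filter M; M \<subseteq> P; minimal_prime_filter N; N \<subseteq> P\<rbrakk> \<Longrightarrow> M = N"

end

theory Submission
  imports Defs
begin

text \<open>
  For a filter \<open>F\<close> let \<open>I\<close> be the set of all \<open>x\<close> whose coannihilator \<open>omega {x}\<close> lies in \<open>F\<close>.
  Since \<open>omega X\<close> is the union of the sets \<open>omega {x}\<close> with \<open>x \<in> X\<close>, a set \<open>X\<close> satisfies
  \<open>omega X \<subseteq> F\<close> exactly when \<open>X \<subseteq> I\<close>. Hence \<open>omega I\<close> is the greatest set of the form \<open>omega X\<close>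
  below \<open>F\<close>, and the whole content of the theorem is that \<open>I\<close> is an ideal of the lattice. Only
  closure under joins is not immediate, and this is where normality enters.

  Let \<open>x, y \<in> I\<close> and suppose that some \<open>a\<close> with \<open>sup (sup x y) a = top\<close> is outside \<open>F\<close>. Separate
  \<open>a\<close> from \<open>F\<close> by a prime filter \<open>P \<supseteq> F\<close>. As \<open>omega {x} \<subseteq> P\<close>, no join of \<open>x\<close> with an element
  outside \<open>P\<close> is \<open>top\<close>, and a second separation argument gives a prime filter inside \<open>P\<close> that
  avoids \<open>x\<close>, hence a minimal prime filter inside \<open>P\<close> avoiding \<open>x\<close>. The same holds for \<open>y\<close>. By
  normality the two minimal prime filters coincide, so a single prime filter contains none of \<open>x\<close>,
  \<open>y\<close>, \<open>a\<close>, although it contains their join \<open>top\<close>.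
\<close>

section \<open>Filters of a residuated lattice\<close>

context residuated_lattice
begin

lemma odot_commute: "x \<odot> y = y \<odot> x"
  and odot_top [simp]: "x \<odot> top = x"
proof -
  interpret comm_monoid odot top by (rule odot_comm_monoid)
  show "x \<odot> y = y \<odot> x" by (rule commute)
  show "x \<odot> top = x" by (rule comm_neutral)
qed

lemma odot_mono_left: "x \<le> x' \<Longrightarrow> x \<odot> y \<le> x' \<odot> y"
  by (meson order_refl order_trans residuation)

lemma odot_mono: "x \<le> x' \<Longrightarrow> y \<le> y' \<Longrightarrow> x \<odot> y \<le> x' \<odot> y'"
  by (metis odot_commute odot_mono_left order_trans)

lemma odot_le_left: "x \<odot> y \<le> x"
  using odot_mono[of x x y top] by simp

text \<open>
  A weak substitute for distributivity: it makes the elements whose join with \<open>z\<close> is in a given filter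
  closed under the product.
\<close>

lemma sup_odot_sup_le: "sup a z \<odot> sup b z \<le> sup (a \<odot> b) z"
proof -
  \<comment> \<open>By residuation it suffices to bound the product for each joinand on its own.\<close>
  have b: "b \<le> a \<rightharpoonup> sup (a \<odot> b) z" and z: "z \<le> a \<rightharpoonup> sup (a \<odot> b) z"
    using odot_le_left[of z a] by (auto simp: residuation[symmetric] odot_commute[of b a] intro: le_supI2)
  have "a \<odot> sup b z \<le> sup (a \<odot> b) z"
    using b z by (simp add: odot_commute[of a] residuation)
  moreover have "z \<odot> sup b z \<le> sup (a \<odot> b) z"
    by (meson odot_le_left le_supI2)
  ultimately show ?thesis
    by (simp add: residuation)
qed

lemma rl_filter_up: "rl_filter F \<Longrightarrow> x \<in> F \<Longrightarrow> x \<le> y \<Longrightarrow> y \<in> F"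
  unfolding rl_filter_def by (metis sup.absorb2)

lemma rl_filter_odot: "rl_filter F \<Longrightarrow> x \<in> F \<Longrightarrow> y \<in> F \<Longrightarrow> x \<odot> y \<in> F"
  unfolding rl_filter_def by blast

lemma rl_filter_top: "rl_filter F \<Longrightarrow> top \<in> F"
  using rl_filter_up[of F _ top] unfolding rl_filter_def by auto

lemma rl_filterI:
  assumes "top \<in> F"
    and "\<And>x y. x \<in> F \<Longrightarrow> y \<in> F \<Longrightarrow> x \<odot> y \<in> F"
    and "\<And>x y. x \<in> F \<Longrightarrow> x \<le> y \<Longrightarrow> y \<in> F"
  shows "rl_filter F"
  using assms unfolding rl_filter_def by (meson empty_iff sup_ge1)

lemma rl_filter_singleton_top: "rl_filter {top}"
  by (rule rl_filterI) (auto simp: top_unique)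

lemma rl_filter_sup_preimage:
  assumes "rl_filter F"
  shows "rl_filter {a. sup a v \<in> F}"
proof (rule rl_filterI)
  show "top \<in> {a. sup a v \<in> F}"
    using assms by (simp add: rl_filter_top)
  show "x \<odot> y \<in> {a. sup a v \<in> F}" if "x \<in> {a. sup a v \<in> F}" "y \<in> {a. sup a v \<in> F}" for x y
    using that assms rl_filter_odot rl_filter_up sup_odot_sup_le by blast
  show "y \<in> {a. sup a v \<in> F}" if "x \<in> {a. sup a v \<in> F}" "x \<le> y" for x y
    using that assms rl_filter_up sup_mono[OF that(2) order_refl] by blast
qed

lemma rl_filter_Union_chain:
  assumes "\<C> \<noteq> {}" and chain: "subset.chain {F. rl_filter F} \<C>"
  shows "rl_filter (\<Union>\<C>)"
proof (rule rl_filterI)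
  have filters: "rl_filter F" if "F \<in> \<C>" for F
    using chain that by (auto simp: subset_chain_def)
  show "top \<in> \<Union>\<C>"
    using assms(1) filters rl_filter_top by blast
  show "y \<in> \<Union>\<C>" if "x \<in> \<Union>\<C>" "x \<le> y" for x y
    using that filters rl_filter_up by blast
  show "x \<odot> y \<in> \<Union>\<C>" if "x \<in> \<Union>\<C>" "y \<in> \<Union>\<C>" for x y
  proof -
    from that obtain F G where FG: "F \<in> \<C>" "x \<in> F" "G \<in> \<C>" "y \<in> G" by blast
    then have "F \<subseteq> G \<or> G \<subseteq> F"
      using chain by (auto simp: subset_chain_def)
    then show ?thesis
      using FG filters rl_filter_odot by (meson UnionI subsetD)
  qed
qed

section \<open>Prime and minimal prime filters\<close>

text \<open>
  A filter that is maximal among those disjoint from a join-closed set \<open>S\<close> is prime. Instead of the filter generated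
  by \<open>Q\<close> and an element, with its powers under the monoid product, the proof enlarges \<open>Q\<close> to the
  filters of all elements whose join with a fixed element lies in \<open>Q\<close>.
\<close>

lemma prime_filter_separation:
  assumes F: "rl_filter F" and disj: "F \<inter> S = {}"
    and "S \<noteq> {}" and sup_closed: "\<And>s t. s \<in> S \<Longrightarrow> t \<in> S \<Longrightarrow> sup s t \<in> S"
  obtains Q where "prime_filter Q" "F \<subseteq> Q" "Q \<inter> S = {}"
proof -
  let ?A = "{Q. rl_filter Q \<and> F \<subseteq> Q \<and> Q \<inter> S = {}}"
  have "\<exists>Q\<in>?A. \<forall>X\<in>?A. Q \<subseteq> X \<longrightarrow> X = Q"
  proof (rule subset_Zorn_nonempty)
    show "?A \<noteq> {}" using F disj by blast
    show "\<Union>\<C> \<in> ?A" if "\<C> \<noteq> {}" "subset.chain ?A \<C>" for \<C>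
    proof -
      have "rl_filter (\<Union>\<C>)"
        using that by (intro rl_filter_Union_chain) (auto simp: subset_chain_def)
      then show ?thesis
        using that by (auto simp: subset_chain_def)
    qed
  qed
  then obtain Q where Q: "rl_filter Q" "F \<subseteq> Q" "Q \<inter> S = {}"
    and max: "\<And>X. rl_filter X \<Longrightarrow> X \<inter> S = {} \<Longrightarrow> Q \<subseteq> X \<Longrightarrow> X = Q"
    by auto
  have meets: "\<exists>s\<in>S. sup s v \<in> Q" if "sup u v \<in> Q" "u \<notin> Q" for u v
  proof (rule ccontr)
    assume "\<not> (\<exists>s\<in>S. sup s v \<in> Q)"
    moreover have "Q \<subseteq> {a. sup a v \<in> Q}"
      using rl_filter_up[OF Q(1) _ sup_ge1] by blast
    ultimately have "{a. sup a v \<in> Q} = Q"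
      using max[OF rl_filter_sup_preimage[OF Q(1)], of v] by blast
    with that show False by blast
  qed
  have "u \<in> Q \<or> v \<in> Q" if uv: "sup u v \<in> Q" for u v
  proof (rule ccontr)
    assume not: "\<not> (u \<in> Q \<or> v \<in> Q)"
    \<comment> \<open>Replace first \<open>u\<close> and then \<open>v\<close> by an element of \<open>S\<close>, keeping the join in \<open>Q\<close>.\<close>
    obtain s where s: "s \<in> S" "sup v s \<in> Q"
      using meets[OF uv] not by (auto simp: sup_commute)
    obtain t where "t \<in> S" "sup t s \<in> Q"
      using meets[OF s(2)] not by auto
    with s sup_closed Q(3) show False by blast
  qed
  moreover have "Q \<noteq> UNIV"
    using Q(3) \<open>S \<noteq> {}\<close> by blast
  ultimately have "prime_filter Q"
    using Q(1) unfolding prime_filter_def by blast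
  with Q that show ?thesis by blast
qed

lemma prime_filter_Inter_chain:
  assumes "\<C> \<noteq> {}" and primes: "\<And>Q. Q \<in> \<C> \<Longrightarrow> prime_filter Q"
    and chain: "\<And>Q R. Q \<in> \<C> \<Longrightarrow> R \<in> \<C> \<Longrightarrow> Q \<subseteq> R \<or> R \<subseteq> Q"
  shows "prime_filter (\<Inter>\<C>)"
proof -
  have filters: "rl_filter Q" if "Q \<in> \<C>" for Q
    using primes that unfolding prime_filter_def by blast
  have "rl_filter (\<Inter>\<C>)"
    by (rule rl_filterI) (auto intro: rl_filter_top rl_filter_odot rl_filter_up filters)
  moreover have "\<Inter>\<C> \<noteq> UNIV"
    using assms(1) primes unfolding prime_filter_def by blast
  moreover have "x \<in> \<Inter>\<C> \<or> y \<in> \<Inter>\<C>" if xy: "sup x y \<in> \<Inter>\<C>" for x y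
  proof (rule ccontr)
    assume "\<not> (x \<in> \<Inter>\<C> \<or> y \<in> \<Inter>\<C>)"
    then obtain Q R where QR: "Q \<in> \<C>" "x \<notin> Q" "R \<in> \<C>" "y \<notin> R" by blast
    \<comment> \<open>The smaller of \<open>Q\<close> and \<open>R\<close> contains neither \<open>x\<close> nor \<open>y\<close>.\<close>
    then obtain T where "T \<in> \<C>" "x \<notin> T" "y \<notin> T"
      using chain by blast
    with xy primes show False
      unfolding prime_filter_def by blast
  qed
  ultimately show ?thesis
    unfolding prime_filter_def by blast
qed

lemma minimal_prime_filter_below:
  assumes P: "prime_filter P"
  obtains M where "minimal_prime_filter M" "M \<subseteq> P"
proof -
  \<comment> \<open>Zorn's lemma for inclusion yields maximal sets, so it is applied to the complements.\<close>
  let ?A = "{X. prime_filter (- X) \<and> - X \<subseteq> P}"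
  have "\<exists>X\<in>?A. \<forall>Y\<in>?A. X \<subseteq> Y \<longrightarrow> Y = X"
  proof (rule subset_Zorn_nonempty)
    show "?A \<noteq> {}"
      using P by (auto intro!: exI[of _ "- P"])
    show "\<Union>\<C> \<in> ?A" if C: "\<C> \<noteq> {}" "subset.chain ?A \<C>" for \<C>
    proof -
      have "prime_filter (\<Inter>(uminus ` \<C>))"
      proof (rule prime_filter_Inter_chain)
        show "uminus ` \<C> \<noteq> {}" using C(1) by blast
        show "prime_filter Q" if "Q \<in> uminus ` \<C>" for Q
          using C(2) that by (auto simp: subset_chain_def)
        show "Q \<subseteq> R \<or> R \<subseteq> Q" if "Q \<in> uminus ` \<C>" "R \<in> uminus ` \<C>" for Q R
        proof -
          from that obtain X Y where "X \<in> \<C>" "Q = - X" "Y \<in> \<C>" "R = - Y" by blast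
          moreover from this have "X \<subseteq> Y \<or> Y \<subseteq> X"
            using C(2) unfolding subset_chain_def by blast
          ultimately show ?thesis by simp blast
        qed
      qed
      moreover have "- \<Union>\<C> = \<Inter>(uminus ` \<C>)" by blast
      moreover have "\<Inter>(uminus ` \<C>) \<subseteq> P"
        using C by (auto simp: subset_chain_def)
      ultimately show ?thesis by simp
    qed
  qed
  then obtain X where "X \<in> ?A" and max: "\<forall>Y\<in>?A. X \<subseteq> Y \<longrightarrow> Y = X" ..
  then have X: "prime_filter (- X)" "- X \<subseteq> P" by simp_all
  have "Q = - X" if Q: "prime_filter Q" "Q \<subseteq> - X" for Q
  proof -
    have "- Q = X"
    proof (rule max[rule_format])
      show "- Q \<in> ?A" using Q X(2) by simp
      show "X \<subseteq> - Q" using Q(2) by blast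
    qed
    then show ?thesis by blast
  qed
  then have "minimal_prime_filter (- X)"
    using X(1) unfolding minimal_prime_filter_def by simp
  then show ?thesis
    using X(2) by (rule that)
qed

text \<open>
  The hypothesis says that the joins of \<open>x\<close> with elements outside \<open>P\<close> are never \<open>top\<close>. These joins,
  together with the complement of \<open>P\<close>, form a join-closed set; a prime filter disjoint from it lies
  inside \<open>P\<close> and avoids \<open>x\<close>.
\<close>

lemma minimal_prime_filter_avoiding:
  assumes P: "prime_filter P" and x: "omega {x} \<subseteq> P"
  obtains M where "minimal_prime_filter M" "M \<subseteq> P" "x \<notin> M"
proof -
  let ?S = "- P \<union> sup x ` (- P)"
  have top: "top \<in> P"
    using P rl_filter_top unfolding prime_filter_def by blast
  have bot: "bot \<notin> P"
    using P rl_filter_up[of P bot] unfolding prime_filter_def by auto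
  have outside: "sup s t \<in> - P" if "s \<in> - P" "t \<in> - P" for s t
    using P that unfolding prime_filter_def by blast
  have "sup s t \<in> ?S" if st: "s \<in> ?S" "t \<in> ?S" for s t
  proof -
    obtain c where c: "c \<in> - P" "s = c \<or> s = sup x c" using st(1) by blast
    obtain d where d: "d \<in> - P" "t = d \<or> t = sup x d" using st(2) by blast
    have "sup s t = sup c d \<or> sup s t = sup x (sup c d)"
      using c(2) d(2) by (auto simp: sup_assoc sup_left_commute)
    then show ?thesis
      using outside[OF c(1) d(1)] by (metis UnI1 UnI2 imageI)
  qed
  moreover have "{top} \<inter> ?S = {}"
  proof -
    have "top \<noteq> sup x c" if "c \<notin> P" for c
      using x that unfolding omega_def by auto
    with top show ?thesis by auto
  qed
  moreover have "?S \<noteq> {}" using bot by blast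
  ultimately obtain Q where Q: "prime_filter Q" "Q \<inter> ?S = {}"
    using prime_filter_separation[OF rl_filter_singleton_top, of ?S] by metis
  obtain M where M: "minimal_prime_filter M" "M \<subseteq> Q"
    using minimal_prime_filter_below[OF Q(1)] by blast
  \<comment> \<open>As \<open>bot\<close> is outside \<open>P\<close>, the element \<open>x\<close> is itself one of the joins.\<close>
  have "x \<in> ?S"
    using bot image_eqI[of x "sup x" bot "- P"] by simp
  then show ?thesis
    using that M Q(2) by blast
qed

section \<open>Omega-filters\<close>

lemma rl_filter_omega:
  assumes "lattice_ideal I"
  shows "rl_filter (omega I)"
proof (rule rl_filterI)
  show "top \<in> omega I"
    using assms unfolding lattice_ideal_def omega_def by auto
  show "b \<in> omega I" if "a \<in> omega I" "a \<le> b" for a b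
  proof -
    from that(1) obtain x where x: "x \<in> I" "sup x a = top"
      unfolding omega_def by blast
    have "sup x b = top"
      using sup_mono[OF order_refl[of x] that(2)] x(2) by (simp add: top_unique)
    with x(1) show ?thesis
      unfolding omega_def by blast
  qed
  show "a \<odot> b \<in> omega I" if ab: "a \<in> omega I" "b \<in> omega I" for a b
  proof -
    from ab obtain x y where xy: "x \<in> I" "sup x a = top" "y \<in> I" "sup y b = top"
      unfolding omega_def by blast
    have "sup a (sup x y) = sup (sup x a) y" "sup b (sup x y) = sup x (sup y b)"
      by (simp_all add: sup_commute sup_left_commute)
    then have "sup a (sup x y) = top" "sup b (sup x y) = top"
      by (simp_all add: xy)
    then have "sup (a \<odot> b) (sup x y) = top"
      using sup_odot_sup_le[of a "sup x y" b] by (simp add: top_unique)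
    moreover have "sup x y \<in> I"
      using assms xy unfolding lattice_ideal_def by blast
    ultimately show ?thesis
      unfolding omega_def by (auto simp: sup_commute[of "a \<odot> b"])
  qed
qed

end

text \<open>
  The converse inclusion being trivial, this says that in the normal case \<open>omega {sup x y}\<close> is the
  join of \<open>omega {x}\<close> and \<open>omega {y}\<close> in the lattice of filters; testing against all filters \<open>F\<close>
  avoids describing that join.
\<close>

lemma omega_sup_subset:
  fixes F :: "'a::normal_residuated_lattice set"
  assumes F: "rl_filter F" and x: "omega {x} \<subseteq> F" and y: "omega {y} \<subseteq> F"
  shows "omega {sup x y} \<subseteq> F"
proof (rule subsetI, rule ccontr)
  fix a assume a: "a \<in> omega {sup x y}" and "a \<notin> F"
  then obtain P where P: "prime_filter P" "F \<subseteq> P" "a \<notin> P"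
    using prime_filter_separation[OF F, of "{a}"] by auto
  obtain M where M: "minimal_prime_filter M" "M \<subseteq> P" "x \<notin> M"
    using minimal_prime_filter_avoiding[OF P(1), of x] x P(2) by blast
  obtain N where N: "minimal_prime_filter N" "N \<subseteq> P" "y \<notin> N"
    using minimal_prime_filter_avoiding[OF P(1), of y] y P(2) by blast
  have "N = M"
    using normal P(1) M N by blast
  moreover have prime: "prime_filter M"
    using M(1) unfolding minimal_prime_filter_def by blast
  ultimately have "sup (sup x y) a \<notin> M"
    using M N P(3) unfolding prime_filter_def by blast
  moreover have "sup (sup x y) a = top"
    using a unfolding omega_def by simp
  moreover have "top \<in> M"
    using prime rl_filter_top unfolding prime_filter_def by blast
  ultimately show False by simp
qed

lemma lattice_ideal_omega_subset:
  fixes F :: "'a::normal_residuated_lattice set"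
  assumes F: "rl_filter F"
  shows "lattice_ideal {x. omega {x} \<subseteq> F}"
proof -
  have "omega {bot} \<subseteq> F"
    using rl_filter_top[OF F] unfolding omega_def by auto
  moreover have "omega {y} \<subseteq> F" if "omega {x} \<subseteq> F" "y \<le> x" for x y
  proof -
    have "sup x a = top" if "sup y a = top" for a
      using sup_mono[OF \<open>y \<le> x\<close> order_refl[of a]] that by (simp add: top_unique)
    then have "omega {y} \<subseteq> omega {x}"
      unfolding omega_def by blast
    with that(1) show ?thesis by blast
  qed
  ultimately show ?thesis
    using omega_sup_subset[OF F] unfolding lattice_ideal_def by blast
qed

theorem proposition4p8:
  fixes F :: "'a::normal_residuated_lattice set"
  assumes "rl_filter F"
  shows "\<exists>G. omega_filter G \<and> G \<subseteq> F \<and> (\<forall>H. omega_filter H \<and> H \<subseteq> F \<longrightarrow> H \<subseteq> G)"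
proof -
  let ?I = "{x. omega {x} \<subseteq> F}"
  have I: "lattice_ideal ?I"
    using assms by (rule lattice_ideal_omega_subset)
  have "omega_filter (omega ?I)"
    using I rl_filter_omega unfolding omega_filter_def by blast
  moreover have "omega ?I \<subseteq> F"
    unfolding omega_def by blast
  moreover have "H \<subseteq> omega ?I" if "omega_filter H" "H \<subseteq> F" for H
    using that unfolding omega_filter_def omega_def by blast
  ultimately show ?thesis by blast
qed

end
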